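(* Let $n\geq 2$, let $k$ be an arbitrary field with algebraic closure $\overline k$, and let $\underline x=(x_1,\ldots,x_n)$. Let $\mathcal S\subset k$ be a finite subset, let $a_0\in\overline k\setminus\mathcal S$ be separable over $k$, and let $V\in k[\underline x]$ be a nonzero polynomial. Then there is an integer $d_0$, depending on $\mathcal S$, $a_0$, $V$, such that for all integers $d_1,\ldots,d_n$ larger than $d_0$ there is a polynomial $U\in k[\underline x]$ such that: (a) $U(\underline x)-aV(\underline x)$ is reducible in $k[\underline x]$ for every $a\in\mathcal S$; (b) $U(\underline x)-a_0V(\underline x)$ is irreducible in $k(a_0)[\underline x]$ of degree $\max(\deg(U),\deg(V))$; (c) $\deg_{x_i}(U)=d_i$, $i=1,\ldots,n$.
   Context: $\deg$ denotes total degree in $\underline x$. *)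

theory Defs
  imports "HOL-Algebra.Algebraic_Closure_Type" "HOL-Algebra.Generated_Fields"
    "HOL-Library.Poly_Mapping"
begin

type_synonym 'a mpoly = "(nat \<Rightarrow>\<^sub>0 nat) \<Rightarrow>\<^sub>0 'a"

text \<open>The ring \<open>K[x\<^sub>1, \<dots>, x\<^sub>n]\<close> for a subring \<open>K\<close> of a type. The type \<open>'a mpoly\<close> has
  a variable for every natural number, so the carrier also fixes which variables may occur.\<close>

definition mpoly_ring :: "nat \<Rightarrow> 'a::comm_ring_1 set \<Rightarrow> 'a mpoly ring" where
  "mpoly_ring n K = ring_of_type_algebra
     \<lparr>carrier := {p. (\<forall>m. Poly_Mapping.lookup p m \<in> K) \<and>
                     (\<forall>m \<in> Poly_Mapping.keys p. Poly_Mapping.keys m \<subseteq> {1..n})}\<rparr>"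

definition mconst :: "'a::zero \<Rightarrow> 'a mpoly" where
  "mconst c = Poly_Mapping.single 0 c"

text \<open>Both degrees give the zero polynomial degree 0.\<close>

definition total_deg :: "'a::zero mpoly \<Rightarrow> nat" where
  "total_deg p =
     Max (insert 0 ((\<lambda>m. \<Sum>i\<in>Poly_Mapping.keys m. Poly_Mapping.lookup m i) ` Poly_Mapping.keys p))"

definition deg_in :: "nat \<Rightarrow> 'a::zero mpoly \<Rightarrow> nat" where
  "deg_in i p = Max (insert 0 ((\<lambda>m. Poly_Mapping.lookup m i) ` Poly_Mapping.keys p))"

abbreviation mpoly_to_ac :: "'k::field mpoly \<Rightarrow> 'k alg_closure mpoly" where
  "mpoly_to_ac \<equiv> Poly_Mapping.map to_ac"

definition ring_reducible :: "('a, 'b) ring_scheme \<Rightarrow> 'a \<Rightarrow> bool" where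
  "ring_reducible R p \<longleftrightarrow>
     p \<in> carrier R \<and> p \<noteq> \<zero>\<^bsub>R\<^esub> \<and> p \<notin> Units R \<and> \<not> ring_irreducible\<^bsub>R\<^esub> p"

definition is_min_poly :: "'k::field poly \<Rightarrow> 'k alg_closure \<Rightarrow> bool" where
  "is_min_poly p a \<longleftrightarrow> lead_coeff p = 1 \<and> poly (map_poly to_ac p) a = 0 \<and>
     (\<forall>q. poly (map_poly to_ac q) a = 0 \<longrightarrow> p dvd q)"

text \<open>\<open>rsquarefree\<close> says that every root is simple; here the roots range over the
  algebraic closure, so this is separability of the minimal polynomial.\<close>

definition separable_elem :: "'k::field alg_closure \<Rightarrow> bool" where
  "separable_elem a \<longleftrightarrow> (\<exists>p. is_min_poly p a \<and> rsquarefree (map_poly to_ac p))"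

definition simple_ext :: "'k::field alg_closure \<Rightarrow> 'k alg_closure set" where
  "simple_ext a = generate_field ring_of_type_algebra (insert a (to_ac ` UNIV))"

end

theory Submission
  imports Defs
begin

text \<open>
  Let \<open>P(t) = \<Prod>\<^bsub>a\<in>S\<^esub> (t - a)\<close>, let \<open>m\<close> be the minimal polynomial of \<open>a\<^sub>0\<close>, and let
  \<open>T = x\<^sub>2 + x\<^sub>1\<^sup>N\<close> with \<open>N\<close> larger than the degree of \<open>V\<close> in \<open>x\<^sub>1\<close>. Take
  \<open>U = V T + P(T) (C(T) + m(T) W)\<close>, where \<open>W = x\<^sub>1\<^bsup>e\<^sub>1\<^esup> x\<^sub>2\<^bsup>e\<^sub>2\<^esup> + x\<^sub>3\<^bsup>e\<^sub>3\<^esup> + \<dots> + x\<^sub>n\<^bsup>e\<^sub>n\<^esup>\<close>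
  tunes the degrees. For \<open>a \<in> S\<close> the polynomial \<open>T - a\<close> divides \<open>U - a V\<close>.

  In the coordinates \<open>x\<^sub>1, y = T, x\<^sub>3, \<dots>, x\<^sub>n\<close> the polynomial \<open>F = U - a\<^sub>0 V\<close> is a nonzero
  constant modulo \<open>y - a\<^sub>0\<close>, while its leading coefficient in \<open>x\<^sub>1\<close> is \<open>\<plusminus> P(y) m(y)\<close>. As \<open>a\<^sub>0\<close> is
  separable, \<open>y - a\<^sub>0\<close> divides the latter exactly once. By Eisenstein's argument with the roles of
  the leading and the constant coefficient exchanged, a factor of \<open>F\<close> over the algebraic closure
  does not involve \<open>x\<^sub>1\<close>, so it divides \<open>P(y) m(y)\<close>. It is a unit because no \<open>y - \<beta>\<close> with \<open>\<beta>\<close> a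
  root of \<open>P m\<close> divides \<open>F\<close>. Hence \<open>F\<close> is even absolutely irreducible.
\<close>

subsection \<open>Substitution homomorphisms\<close>

text \<open>Keeps the numeral \<open>1\<close> from being rewritten to \<open>Suc 0\<close>, as it
  serves as the index of the first variable.\<close>

declare One_nat_def [simp del]

text \<open>Constants, evaluations, base change and coordinate changes are all instances, so each of
  them inherits compatibility with sums, powers and polynomials.\<close>

locale comm_ring_hom =
  fixes h :: "'a::comm_ring_1 \<Rightarrow> 'b::comm_ring_1"
  assumes one: "h 1 = 1" and add: "h (x + y) = h x + h y" and mult: "h (x * y) = h x * h y"
begin

lemma zero: "h 0 = 0"
  using add[of 0 0] by simp

lemma minus: "h (- x) = - h x"
  using add[of x "- x"] zero by (simp add: eq_neg_iff_add_eq_0 add.commute)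

lemma diff: "h (x - y) = h x - h y"
  using add[of x "- y"] minus by simp

lemma power: "h (x ^ k) = h x ^ k"
  by (induction k) (simp_all add: one mult)

lemma sum: "h (\<Sum>i\<in>A. u i) = (\<Sum>i\<in>A. h (u i))"
  by (induction A rule: infinite_finite_induct) (simp_all add: zero add)

lemma prod: "h (\<Prod>i\<in>A. u i) = (\<Prod>i\<in>A. h (u i))"
  by (induction A rule: infinite_finite_induct) (simp_all add: one mult)

lemma poly: "h (poly p x) = poly (map_poly h p) (h x)"
  by (induction p) (simp_all add: zero add mult map_poly_pCons)

lemma comp: "comm_ring_hom k \<Longrightarrow> comm_ring_hom (\<lambda>x. k (h x))"
  by (simp add: comm_ring_hom_def one add mult)

lemma map_poly_hom: "comm_ring_hom (map_poly h)"
proof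
  show "map_poly h 1 = 1" by (simp add: one)
  show "map_poly h (p + q) = map_poly h p + map_poly h q" for p q
    by (intro poly_eqI) (simp add: coeff_map_poly zero add)
  show "map_poly h (p * q) = map_poly h p * map_poly h q" for p q
    by (intro poly_eqI) (simp add: coeff_map_poly zero coeff_mult sum mult)
qed

end

lemma comm_ring_hom_const_poly: "comm_ring_hom (\<lambda>c. [:c:])"
  by unfold_locales (simp_all add: one_pCons)

lemma comm_ring_hom_poly: "comm_ring_hom (\<lambda>p. poly p a)"
  by unfold_locales simp_all

lemma comm_ring_hom_to_ac: "comm_ring_hom to_ac"
  by unfold_locales simp_all

lemma comm_ring_hom_mconst: "comm_ring_hom mconst"
  by unfold_locales (simp_all add: mconst_def single_add mult_single)

lemma mconst_eq_0_iff: "mconst c = 0 \<longleftrightarrow> c = 0"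
  by (metis mconst_def single_zero lookup_single_eq lookup_zero)

section \<open>Substitution into multivariate polynomials\<close>

definition mvar :: "nat \<Rightarrow> 'a::comm_ring_1 mpoly" where
  "mvar i = Poly_Mapping.single (Poly_Mapping.single i 1) 1"

definition monom_val :: "(nat \<Rightarrow> 'b::comm_ring_1) \<Rightarrow> (nat \<Rightarrow>\<^sub>0 nat) \<Rightarrow> 'b" where
  "monom_val g m = (\<Prod>i\<in>Poly_Mapping.keys m. g i ^ Poly_Mapping.lookup m i)"

text \<open>The map given by the universal property of polynomial rings; it is a ring homomorphism
  whenever \<open>f\<close> is one.\<close>

definition mpoly_subst :: "('a::comm_ring_1 \<Rightarrow> 'b::comm_ring_1) \<Rightarrow> (nat \<Rightarrow> 'b) \<Rightarrow> 'a mpoly \<Rightarrow> 'b" where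
  "mpoly_subst f g p =
     (\<Sum>m\<in>Poly_Mapping.keys p. f (Poly_Mapping.lookup p m) * monom_val g m)"

text \<open>Padding with zero exponents lets several monomials be handled over one common index
  set.\<close>

lemma monom_val_superset:
  assumes "finite A" "Poly_Mapping.keys m \<subseteq> A"
  shows "monom_val g m = (\<Prod>i\<in>A. g i ^ Poly_Mapping.lookup m i)"
  unfolding monom_val_def using assms
  by (intro prod.mono_neutral_left) (auto simp: in_keys_iff)

lemma monom_val_add: "monom_val g (m + m') = monom_val g m * monom_val g m'"
proof -
  let ?A = "Poly_Mapping.keys m \<union> Poly_Mapping.keys m'"
  have "finite ?A" by simp
  moreover have "Poly_Mapping.keys (m + m') \<subseteq> ?A" by (rule keys_add)
  ultimately show ?thesis
    by (simp add: monom_val_superset[of ?A] lookup_add power_add prod.distrib)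
qed

lemma monom_val_0 [simp]: "monom_val g 0 = 1"
  by (simp add: monom_val_def)

lemma monom_val_single: "monom_val g (Poly_Mapping.single i k) = g i ^ k"
  by (simp add: monom_val_def)

lemma poly_mapping_sum_single:
  "(\<Sum>m\<in>Poly_Mapping.keys p. Poly_Mapping.single m (Poly_Mapping.lookup p m)) = p"
proof (rule poly_mapping_eqI)
  fix k
  have "Poly_Mapping.lookup (\<Sum>m\<in>Poly_Mapping.keys p. Poly_Mapping.single m (Poly_Mapping.lookup p m)) k
    = (\<Sum>m\<in>Poly_Mapping.keys p. if m = k then Poly_Mapping.lookup p m else 0)"
    by (simp add: lookup_sum lookup_single when_def)
  also have "\<dots> = Poly_Mapping.lookup p k"
    by (simp add: in_keys_iff)
  finally show "Poly_Mapping.lookup (\<Sum>m\<in>Poly_Mapping.keys p. Poly_Mapping.single m (Poly_Mapping.lookup p m)) k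
    = Poly_Mapping.lookup p k" .
qed

context comm_ring_hom
begin

lemma subst_superset:
  assumes "finite A" "Poly_Mapping.keys p \<subseteq> A"
  shows "mpoly_subst h g p = (\<Sum>m\<in>A. h (Poly_Mapping.lookup p m) * monom_val g m)"
  unfolding mpoly_subst_def using assms
  by (intro sum.mono_neutral_left) (auto simp: in_keys_iff zero)

lemma subst_single: "mpoly_subst h g (Poly_Mapping.single m c) = h c * monom_val g m"
  by (simp add: mpoly_subst_def zero)

lemma subst_add: "mpoly_subst h g (p + q) = mpoly_subst h g p + mpoly_subst h g q"
proof -
  let ?A = "Poly_Mapping.keys p \<union> Poly_Mapping.keys q"
  have "finite ?A" by simp
  moreover have "Poly_Mapping.keys (p + q) \<subseteq> ?A" by (rule keys_add)
  ultimately show ?thesis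
    by (simp add: subst_superset[of ?A] lookup_add add distrib_right sum.distrib)
qed

lemma subst_sum: "mpoly_subst h g (\<Sum>i\<in>A. u i) = (\<Sum>i\<in>A. mpoly_subst h g (u i))"
  by (induction A rule: infinite_finite_induct) (simp_all add: subst_add mpoly_subst_def[of _ _ 0])

text \<open>Both factors are split into their terms, and for a product of two terms the claim is
  \<open>monom_val_add\<close>.\<close>

lemma subst_mult: "mpoly_subst h g (p * q) = mpoly_subst h g p * mpoly_subst h g q"
proof -
  let ?s = "\<lambda>r m. Poly_Mapping.single m (Poly_Mapping.lookup r m)"
  have "mpoly_subst h g (p * q) = mpoly_subst h g
      ((\<Sum>m\<in>Poly_Mapping.keys p. ?s p m) * (\<Sum>m\<in>Poly_Mapping.keys q. ?s q m))"
    by (simp only: poly_mapping_sum_single)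
  also have "\<dots> = (\<Sum>m\<in>Poly_Mapping.keys p. \<Sum>m'\<in>Poly_Mapping.keys q.
      mpoly_subst h g (?s p m) * mpoly_subst h g (?s q m'))"
    by (simp add: sum_product subst_sum mult_single subst_single mult monom_val_add mult_ac)
  also have "\<dots> = mpoly_subst h g (\<Sum>m\<in>Poly_Mapping.keys p. ?s p m) *
      mpoly_subst h g (\<Sum>m\<in>Poly_Mapping.keys q. ?s q m)"
    by (simp add: subst_sum sum_product)
  finally show ?thesis by (simp only: poly_mapping_sum_single)
qed

lemma subst_mconst [simp]: "mpoly_subst h g (mconst c) = h c"
  by (simp add: mconst_def subst_single)

lemma subst_mvar [simp]: "mpoly_subst h g (mvar i) = g i"
  by (simp add: mvar_def subst_single monom_val_single one)

lemma subst_hom: "comm_ring_hom (mpoly_subst h g)"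
proof
  show "mpoly_subst h g 1 = 1"
    using subst_single[of g 0 1] by (simp add: one)
qed (simp_all add: subst_add subst_mult)

lemma hom_subst: "h (mpoly_subst f g p) = mpoly_subst (\<lambda>c. h (f c)) (\<lambda>i. h (g i)) p"
  by (simp add: mpoly_subst_def monom_val_def sum mult prod power)

end

lemma monom_val_mvar: "monom_val mvar m = Poly_Mapping.single m 1"
proof -
  have *: "mvar i ^ k = Poly_Mapping.single (Poly_Mapping.single i k) (1::'a)" for i k
    by (induction k) (simp_all add: mvar_def mult_single single_add[symmetric] One_nat_def)
  have "(\<Prod>i\<in>A. Poly_Mapping.single (f i) (1::'a)) = Poly_Mapping.single (\<Sum>i\<in>A. f i) 1"
    if "finite A" for A and f :: "nat \<Rightarrow> nat \<Rightarrow>\<^sub>0 nat"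
    using that by induction (simp_all add: mult_single)
  then show ?thesis
    by (simp add: monom_val_def * poly_mapping_sum_single)
qed

lemma mpoly_subst_id: "mpoly_subst mconst mvar p = p"
  by (simp add: mpoly_subst_def mconst_def mult_single poly_mapping_sum_single monom_val_mvar)

lemma mpoly_subst_map:
  assumes "\<And>c. f c = 0 \<longleftrightarrow> c = 0"
  shows "mpoly_subst h g (Poly_Mapping.map f p) = mpoly_subst (\<lambda>c. h (f c)) g p"
proof -
  have l: "Poly_Mapping.lookup (Poly_Mapping.map f p) m = f (Poly_Mapping.lookup p m)" for m
    using assms by transfer (simp add: when_def)
  then have "Poly_Mapping.keys (Poly_Mapping.map f p) = Poly_Mapping.keys p"
    by (auto simp: in_keys_iff assms)
  then show ?thesis by (simp add: mpoly_subst_def l)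
qed

text \<open>Congruence modulo \<open>d\<close> passes to powers, since a - b divides a^k - b^k, and
  to products by telescoping.\<close>

lemma dvd_monom_val_diff:
  assumes "\<And>i. d dvd g i - g' i"
  shows "d dvd monom_val g m - monom_val g' m"
proof -
  have pow: "d dvd a ^ k - b ^ k" if "d dvd a - b" for a b :: 'a and k
    using that by (metis dvd_mult2 power_diff_sumr2)
  have "d dvd (\<Prod>i\<in>A. u i) - (\<Prod>i\<in>A. v i)"
    if "finite A" "\<And>i. d dvd u i - v i" for A and u v :: "nat \<Rightarrow> 'a"
    using that(1)
  proof induction
    case (insert i A)
    have "prod u (insert i A) - prod v (insert i A)
      = (u i - v i) * prod u A + v i * (prod u A - prod v A)"
      using insert by (simp add: algebra_simps)
    then show ?case using insert.IH that(2)[of i] by simp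
  qed simp
  then show ?thesis
    unfolding monom_val_def using pow[OF assms] by simp
qed

text \<open>Applied later with \<open>d\<close> equal to x_2 + x_1^N - \<beta>, where it turns an
  identity on the hypersurface d = 0 into divisibility by \<open>d\<close>.\<close>

lemma dvd_mpoly_subst_diff:
  assumes "\<And>i. d dvd g i - g' i"
  shows "d dvd mpoly_subst f g p - mpoly_subst f g' p"
  unfolding mpoly_subst_def sum_subtractf[symmetric] right_diff_distrib[symmetric]
  by (intro dvd_sum dvd_mult dvd_monom_val_diff assms)

subsection \<open>Degrees of multivariate polynomials\<close>

text \<open>The coefficients stay in the full type \<open>'a mpoly\<close>, although they do not
  involve x_i, so that the theory of univariate degrees applies directly.\<close>

definition split_var :: "nat \<Rightarrow> 'a::comm_ring_1 mpoly \<Rightarrow> 'a mpoly poly" where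
  "split_var i = mpoly_subst (\<lambda>c. [:mconst c:]) (\<lambda>j. if j = i then [:0, 1:] else [:mvar j:])"

lemma comm_ring_hom_mconst_poly: "comm_ring_hom (\<lambda>c. [:mconst c:])"
  using comm_ring_hom.comp[OF comm_ring_hom_mconst comm_ring_hom_const_poly] .

lemma split_var_hom: "comm_ring_hom (split_var i)"
  unfolding split_var_def by (rule comm_ring_hom.subst_hom[OF comm_ring_hom_mconst_poly])

lemma split_var_mconst: "split_var i (mconst c) = [:mconst c:]"
  unfolding split_var_def by (rule comm_ring_hom.subst_mconst[OF comm_ring_hom_mconst_poly])

lemma split_var_mvar: "split_var i (mvar j) = (if j = i then [:0, 1:] else [:mvar j:])"
  unfolding split_var_def by (rule comm_ring_hom.subst_mvar[OF comm_ring_hom_mconst_poly])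

lemma split_var_eq:
  "split_var i p = (\<Sum>m\<in>Poly_Mapping.keys p. monom (Poly_Mapping.single
     (m - Poly_Mapping.single i (Poly_Mapping.lookup m i)) (Poly_Mapping.lookup p m))
     (Poly_Mapping.lookup m i))"
proof -
  interpret C: comm_ring_hom "\<lambda>c::'a mpoly. [:c:]" by (rule comm_ring_hom_const_poly)
  have "monom_val (\<lambda>j. if j = i then [:0, 1:] else [:mvar j:]) m =
      monom (Poly_Mapping.single (m - Poly_Mapping.single i (Poly_Mapping.lookup m i)) (1::'a))
        (Poly_Mapping.lookup m i)" (is "monom_val ?g m = _") for m
  proof -
    define m' where "m' = m - Poly_Mapping.single i (Poly_Mapping.lookup m i)"
    have m: "m = Poly_Mapping.single i (Poly_Mapping.lookup m i) + m'"
      by (rule poly_mapping_eqI)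
        (simp add: m'_def lookup_add lookup_minus lookup_single when_def)
    have "Poly_Mapping.lookup m' i = 0"
      by (simp add: m'_def lookup_minus)
    then have "monom_val ?g m' = monom_val (\<lambda>j. [:mvar j:]) m'"
      unfolding monom_val_def by (intro prod.cong refl) (auto simp: in_keys_iff)
    also have "\<dots> = [:monom_val mvar m':]"
      unfolding monom_val_def by (simp add: C.prod C.power)
    finally have "monom_val ?g m' = [:Poly_Mapping.single m' 1:]"
      by (simp add: monom_val_mvar)
    moreover have "monom_val ?g m = [:0, 1:] ^ Poly_Mapping.lookup m i * monom_val ?g m'"
      by (subst m) (simp add: monom_val_add monom_val_single)
    ultimately show ?thesis
      by (simp add: m'_def monom_altdef mult_ac)
  qed
  then show ?thesis
    by (simp add: split_var_def mpoly_subst_def smult_monom mconst_def mult_single)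
qed

lemma deg_in_le: "m \<in> Poly_Mapping.keys p \<Longrightarrow> Poly_Mapping.lookup m i \<le> deg_in i p"
  unfolding deg_in_def by (intro Max_ge) auto

lemma deg_in_attained:
  assumes "deg_in i p > 0"
  shows "\<exists>m\<in>Poly_Mapping.keys p. Poly_Mapping.lookup m i = deg_in i p"
proof -
  have "deg_in i p \<in> insert 0 ((\<lambda>m. Poly_Mapping.lookup m i) ` Poly_Mapping.keys p)"
    unfolding deg_in_def by (intro Max_in) auto
  then show ?thesis using assms by auto
qed

text \<open>Makes the rules for univariate degrees available for \<open>deg_in\<close>, which is
  defined through exponents.\<close>

lemma deg_in_eq_degree: "deg_in i p = degree (split_var i p)"
proof (rule antisym)
  show "degree (split_var i p) \<le> deg_in i p"
    unfolding split_var_eq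
    by (intro degree_sum_le) (auto intro: order_trans[OF degree_monom_le] deg_in_le)
  show "deg_in i p \<le> degree (split_var i p)"
  proof (cases "deg_in i p = 0")
    case False
    then obtain m where m: "m \<in> Poly_Mapping.keys p" "Poly_Mapping.lookup m i = deg_in i p"
      using deg_in_attained by blast
    let ?r = "\<lambda>m. m - Poly_Mapping.single i (Poly_Mapping.lookup m i)"
    \<comment> \<open>A monomial is determined by its exponent at \<open>i\<close> together with the
      remaining exponents, so no other term of \<open>p\<close> can cancel the chosen one.\<close>
    have inj: "m' = m"
      if "Poly_Mapping.lookup m' i = Poly_Mapping.lookup m i" "?r m' = ?r m" for m'
    proof (rule poly_mapping_eqI)
      fix k
      have "Poly_Mapping.lookup (?r m') k = Poly_Mapping.lookup (?r m) k"
        using that(2) by simp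
      then show "Poly_Mapping.lookup m' k = Poly_Mapping.lookup m k"
        using that(1) by (cases "k = i") (simp_all add: lookup_minus lookup_single when_def)
    qed
    have "Poly_Mapping.lookup (coeff (split_var i p) (deg_in i p)) (?r m) =
        (\<Sum>m'\<in>Poly_Mapping.keys p. if m' = m then Poly_Mapping.lookup p m' else 0)"
      unfolding split_var_eq coeff_sum lookup_sum
      using inj m(2) by (intro sum.cong refl) (auto simp: lookup_single when_def)
    also have "\<dots> = Poly_Mapping.lookup p m" using m by simp
    also have "\<dots> \<noteq> 0" using m by (simp add: in_keys_iff)
    finally have "coeff (split_var i p) (deg_in i p) \<noteq> 0" by auto
    then show ?thesis by (rule le_degree)
  qed simp
qed

text \<open>Evaluating the outer variable at x_i recovers \<open>p\<close>.\<close>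

lemma split_var_eq_0_iff: "split_var i p = 0 \<longleftrightarrow> p = 0"
proof
  assume *: "split_var i p = 0"
  interpret ev: comm_ring_hom "\<lambda>q::'a mpoly poly. poly q (mvar i)" by (rule comm_ring_hom_poly)
  have "poly (split_var i p) (mvar i) = mpoly_subst mconst mvar p"
    unfolding split_var_def ev.hom_subst by (rule arg_cong3[of _ _ _ _ _ _ mpoly_subst]) auto
  then show "p = 0" using * by (simp add: mpoly_subst_id)
qed (simp add: split_var_eq)

lemma deg_in_mult:
  fixes p q :: "'a::idom mpoly"
  assumes "p \<noteq> 0" "q \<noteq> 0"
  shows "deg_in i (p * q) = deg_in i p + deg_in i q"
  using assms unfolding deg_in_eq_degree comm_ring_hom.mult[OF split_var_hom]
  by (intro degree_mult_eq) (simp_all add: split_var_eq_0_iff)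

lemma deg_in_mconst: "deg_in i (mconst c) = 0"
  by (simp add: deg_in_def mconst_def)

text \<open>Degrees add up to 0 in every variable, so 0 is the only possible exponent
  vector.\<close>

lemma mpoly_unit_imp_const:
  fixes p :: "'a::idom mpoly"
  assumes "p dvd 1"
  shows "\<exists>c. c \<noteq> 0 \<and> p = mconst c"
proof -
  obtain q where pq: "p * q = 1" using assms by (metis dvdE)
  then have nz: "p \<noteq> 0" "q \<noteq> 0" by auto
  have "deg_in i p + deg_in i q = 0" for i
    using deg_in_mult[OF nz, of i] deg_in_mconst[of i "1::'a"] by (simp add: pq mconst_def)
  then have "m = 0" if "m \<in> Poly_Mapping.keys p" for m
    using deg_in_le[OF that] by (intro poly_mapping_eqI) (metis add_is_0 le_zero_eq lookup_zero)
  then have "p = mconst (Poly_Mapping.lookup p 0)"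
    unfolding mconst_def by (intro poly_mapping_eqI)
      (metis in_keys_iff lookup_single_eq lookup_single_not_eq)
  then show ?thesis using nz by (metis mconst_def single_zero)
qed

lemma deg_in_add_left: "deg_in i q < deg_in i p \<Longrightarrow> deg_in i (p + q) = deg_in i p"
  for p q :: "'a::comm_ring_1 mpoly"
  by (simp add: deg_in_eq_degree comm_ring_hom.add[OF split_var_hom] degree_add_eq_left)

lemma deg_in_add_le: "deg_in i p \<le> k \<Longrightarrow> deg_in i q \<le> k \<Longrightarrow> deg_in i (p + q) \<le> k"
  for p q :: "'a::comm_ring_1 mpoly"
  by (simp add: deg_in_eq_degree comm_ring_hom.add[OF split_var_hom] degree_add_le)

lemma deg_in_sum_le: "(\<And>j. j \<in> A \<Longrightarrow> deg_in i (u j) \<le> k) \<Longrightarrow> deg_in i (\<Sum>j\<in>A. u j) \<le> k"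
  for u :: "'b \<Rightarrow> 'a::comm_ring_1 mpoly"
  by (induction A rule: infinite_finite_induct) (auto intro: deg_in_add_le simp: deg_in_def[of _ 0])

lemma deg_in_mvar_power: "deg_in i (mvar j ^ k :: 'a::idom mpoly) = (if i = j then k else 0)"
proof -
  interpret s: comm_ring_hom "split_var i :: 'a mpoly \<Rightarrow> _" by (rule split_var_hom)
  show ?thesis
    by (simp add: deg_in_eq_degree s.power split_var_mvar degree_power_eq
        flip: comm_ring_hom.power[OF comm_ring_hom_const_poly])
qed

lemma mvar_power_neq_0: "mvar j ^ k \<noteq> (0 :: 'a::idom mpoly)"
  using deg_in_mvar_power[of j j 1, where 'a = 'a] by (auto simp: deg_in_def)

text \<open>Splitting off x_i turns the evaluation at \<open>q\<close> into a composition of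
  univariate polynomials, whose degrees multiply.\<close>

lemma deg_in_poly:
  fixes p :: "'a::idom poly"
  shows "deg_in i (poly (map_poly mconst p) q) = degree p * deg_in i q"
proof -
  interpret s: comm_ring_hom "split_var i :: 'a mpoly \<Rightarrow> _" by (rule split_var_hom)
  interpret m: comm_ring_hom "mconst :: 'a \<Rightarrow> _" by (rule comm_ring_hom_mconst)
  have deg: "degree (map_poly mconst p :: 'a mpoly poly) = degree p"
    by (rule degree_map_poly) (simp add: mconst_eq_0_iff)
  have "split_var i (poly (map_poly mconst p) q) =
      pcompose (map_poly mconst p) (split_var i q)"
    by (simp add: s.poly pcompose_altdef map_poly_map_poly s.zero m.zero split_var_mconst o_def)
  then show ?thesis
    by (simp add: deg_in_eq_degree degree_pcompose deg)
qed

section \<open>Total degree\<close>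

lemma deg_in_le_total_deg:
  "deg_in i p \<le> total_deg p"
proof -
  have "Poly_Mapping.lookup m i \<le> total_deg p" if "m \<in> Poly_Mapping.keys p" for m
  proof -
    have "Poly_Mapping.lookup m i \<le> (\<Sum>i\<in>Poly_Mapping.keys m. Poly_Mapping.lookup m i)"
      by (cases "i \<in> Poly_Mapping.keys m") (auto intro: member_le_sum simp: in_keys_iff)
    also have "\<dots> \<le> total_deg p"
      unfolding total_deg_def using that by (intro Max_ge) auto
    finally show ?thesis .
  qed
  then show ?thesis unfolding deg_in_def by (subst Max_le_iff) auto
qed

text \<open>A monomial of maximal total degree in \<open>p\<close> does not occur in
  \<open>q\<close>, so it survives in the sum.\<close>

lemma total_deg_add_left:
  fixes p q :: "'a::comm_ring_1 mpoly"
  assumes "total_deg q < total_deg p"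
  shows "total_deg (p + q) = total_deg p"
proof -
  let ?s = "\<lambda>m::nat \<Rightarrow>\<^sub>0 nat. \<Sum>i\<in>Poly_Mapping.keys m. Poly_Mapping.lookup m i"
  have le: "?s m \<le> total_deg r" if "m \<in> Poly_Mapping.keys r" for m and r :: "'a mpoly"
    unfolding total_deg_def using that by (intro Max_ge) auto
  have "total_deg p \<in> insert 0 (?s ` Poly_Mapping.keys p)"
    unfolding total_deg_def by (intro Max_in) auto
  then obtain m where m: "m \<in> Poly_Mapping.keys p" "?s m = total_deg p" using assms by auto
  have "m \<notin> Poly_Mapping.keys q" using le[of m q] m assms by auto
  then have "m \<in> Poly_Mapping.keys (p + q)"
    using m by (simp add: in_keys_iff lookup_add)
  then have "total_deg p \<le> total_deg (p + q)" using le m by metis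
  moreover have "?s m' \<le> total_deg p" if "m' \<in> Poly_Mapping.keys (p + q)" for m'
    using that keys_add[of p q] le[of m' p] le[of m' q] assms by fastforce
  then have "total_deg (p + q) \<le> total_deg p"
    unfolding total_deg_def[of "p + q"] by (subst Max_le_iff) auto
  ultimately show ?thesis by simp
qed

lemma total_deg_mono: "Poly_Mapping.keys p \<subseteq> Poly_Mapping.keys q \<Longrightarrow> total_deg p \<le> total_deg q"
  unfolding total_deg_def by (intro Max_mono) auto

lemma total_deg_const_mult_le: "total_deg (mconst c * p) \<le> total_deg p"
  using keys_mult[of "mconst c" p] by (intro total_deg_mono) (auto simp: mconst_def split: if_splits)

section \<open>Base change to the algebraic closure\<close>

lemma keys_mpoly_to_ac: "Poly_Mapping.keys (mpoly_to_ac p) = Poly_Mapping.keys p"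
  by transfer (auto simp: when_def)

lemma lookup_mpoly_to_ac: "Poly_Mapping.lookup (mpoly_to_ac p) m = to_ac (Poly_Mapping.lookup p m)"
  by transfer (auto simp: when_def)

lemma mpoly_to_ac_eq_subst: "mpoly_to_ac p = mpoly_subst (\<lambda>c. mconst (to_ac c)) mvar p"
  using mpoly_subst_map[of to_ac mconst mvar p] by (simp add: mpoly_subst_id)

lemma mconst_to_ac_hom: "comm_ring_hom (\<lambda>c. mconst (to_ac c))"
  using comm_ring_hom.comp[OF comm_ring_hom_to_ac comm_ring_hom_mconst] .

lemma mpoly_to_ac_hom: "comm_ring_hom mpoly_to_ac"
  unfolding mpoly_to_ac_eq_subst[abs_def] by (rule comm_ring_hom.subst_hom[OF mconst_to_ac_hom])

lemma mpoly_to_ac_mconst: "mpoly_to_ac (mconst c) = mconst (to_ac c)"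
  unfolding mpoly_to_ac_eq_subst by (rule comm_ring_hom.subst_mconst[OF mconst_to_ac_hom])

lemma mpoly_to_ac_mvar: "mpoly_to_ac (mvar i) = mvar i"
  unfolding mpoly_to_ac_eq_subst by (rule comm_ring_hom.subst_mvar[OF mconst_to_ac_hom])

subsection \<open>Absolute irreducibility\<close>

text \<open>Modulo y - \<alpha> the product is a nonzero constant, so both reduced factors are
  constants. If both factors had positive degree, both leading coefficients would vanish at
  \<alpha>, and (y - \<alpha>)^2 would divide the leading coefficient of \<open>f\<close>.\<close>

lemma reverse_eisenstein:
  fixes f g h :: "'r::idom poly poly"
  assumes f: "f = g * h" and lead: "lead_coeff f = [:-\<alpha>, 1:] * w" and w: "poly w \<alpha> \<noteq> 0"
    and red: "map_poly (\<lambda>q. poly q \<alpha>) f = [:c:]" and c: "c \<noteq> 0"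
  shows "degree g = 0 \<or> degree h = 0"
proof (rule ccontr)
  assume neg: "\<not> ?thesis"
  let ?\<rho> = "map_poly (\<lambda>q. poly q \<alpha>)"
  interpret ev: comm_ring_hom ?\<rho>
    by (intro comm_ring_hom.map_poly_hom comm_ring_hom_poly)
  have gh: "?\<rho> g * ?\<rho> h = [:c:]"
    using red unfolding f ev.mult .
  then have "?\<rho> g \<noteq> 0" "?\<rho> h \<noteq> 0" using c by auto
  then have "degree (?\<rho> g) + degree (?\<rho> h) = 0"
    using gh by (metis degree_mult_eq degree_pCons_0)
  then have "coeff (?\<rho> g) (degree g) = 0" "coeff (?\<rho> h) (degree h) = 0"
    using neg by (auto intro!: coeff_eq_0)
  then have "poly (lead_coeff g) \<alpha> = 0" "poly (lead_coeff h) \<alpha> = 0"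
    by (simp_all add: coeff_map_poly)
  then obtain u v where u: "lead_coeff g = [:-\<alpha>, 1:] * u" and v: "lead_coeff h = [:-\<alpha>, 1:] * v"
    by (metis dvdE poly_eq_0_iff_dvd)
  have "[:-\<alpha>, 1:] * w = [:-\<alpha>, 1:] * ([:-\<alpha>, 1:] * (u * v))"
    using lead unfolding f lead_coeff_mult u v by (simp only: mult_ac)
  then have "w = [:-\<alpha>, 1:] * (u * v)"
    by (metis mult_left_cancel pCons_eq_0_iff zero_neq_one)
  then show False using w by simp
qed

text \<open>Each x in \<open>A\<close> is a root of the product but not of \<open>g\<close>, hence
  of \<open>q\<close>, and the linear factor cancels. This needs no unique factorization in the
  coefficient ring.\<close>

lemma factor_of_linear_factors_without_roots:
  fixes g :: "'r::idom poly"
  assumes "g * q = smult u (\<Prod>x\<in>#A. [:-x, 1:])" "u dvd 1" "\<forall>x\<in>#A. poly g x \<noteq> 0"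
  shows "\<exists>c. g = [:c:] \<and> c dvd 1"
  using assms
proof (induction A arbitrary: q)
  case empty
  then have "g * q dvd 1" by (simp add: is_unit_const_poly_iff)
  then have "g dvd 1" by (rule dvd_mult_left)
  then show ?case by (auto simp: is_unit_poly_iff)
next
  case (add x A)
  have "poly (g * q) x = 0" using add.prems(1) by simp
  then have "poly q x = 0" using add.prems(3) by simp
  then obtain r where r: "q = [:-x, 1:] * r"
    by (metis dvdE poly_eq_0_iff_dvd)
  have "[:-x, 1:] * (g * r) = [:-x, 1:] * smult u (\<Prod>x\<in>#A. [:-x, 1:])"
    using add.prems(1) unfolding r
    by (simp del: mult_pCons_left mult_pCons_right add: mult_ac)
  then have "g * r = smult u (\<Prod>x\<in>#A. [:-x, 1:])"
    by (metis mult_left_cancel pCons_eq_0_iff zero_neq_one)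
  then show ?case using add.IH add.prems by simp
qed

text \<open>The polynomial is rewritten in \<open>x\<^sub>1\<close> (outer variable) and \<open>y = x\<^sub>2 + x\<^sub>1\<^sup>N\<close> (inner variable).\<close>

definition shear :: "nat \<Rightarrow> 'a::comm_ring_1 mpoly \<Rightarrow> 'a mpoly poly poly" where
  "shear N = mpoly_subst (\<lambda>c. [:[:mconst c:]:])
     (\<lambda>i. if i = 1 then [:0, 1:] else if i = 2 then [:[:0, 1:]:] - [:0, 1:] ^ N else [:[:mvar i:]:])"

text \<open>For \<open>t\<close> equal to x_2 + x_1^N this undoes \<open>shear N\<close>; for a
  constant \<open>t\<close> it restricts to the hypersurface x_2 + x_1^N = t.\<close>

definition specialize :: "'a::comm_ring_1 mpoly \<Rightarrow> 'a mpoly poly poly \<Rightarrow> 'a mpoly" where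
  "specialize t q = poly (map_poly (\<lambda>r. poly r t) q) (mvar 1)"

lemma comm_ring_hom_mconst_poly_poly: "comm_ring_hom (\<lambda>c. [:[:mconst c:]:])"
  using comm_ring_hom.comp[OF comm_ring_hom_mconst_poly comm_ring_hom_const_poly] .

lemma shear_hom: "comm_ring_hom (shear N)"
  unfolding shear_def by (rule comm_ring_hom.subst_hom[OF comm_ring_hom_mconst_poly_poly])

lemma shear_mconst: "shear N (mconst c) = [:[:mconst c:]:]"
  unfolding shear_def by (rule comm_ring_hom.subst_mconst[OF comm_ring_hom_mconst_poly_poly])

lemma shear_mvar: "shear N (mvar i) =
    (if i = 1 then [:0, 1:] else if i = 2 then [:[:0, 1:]:] - [:0, 1:] ^ N else [:[:mvar i:]:])"
  unfolding shear_def by (rule comm_ring_hom.subst_mvar[OF comm_ring_hom_mconst_poly_poly])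

lemma specialize_hom: "comm_ring_hom (specialize t)"
  unfolding specialize_def
  by (rule comm_ring_hom.comp[OF comm_ring_hom.map_poly_hom[OF comm_ring_hom_poly] comm_ring_hom_poly])

lemma specialize_shear:
  "specialize t (shear N p) =
     mpoly_subst mconst (\<lambda>i. if i = 2 then t - mvar 1 ^ N else mvar i) p"
proof -
  interpret comm_ring_hom "specialize t" by (rule specialize_hom)
  have *: "specialize t [:[:c:]:] = c" "specialize t [:0, 1:] = mvar 1" "specialize t [:[:0, 1:]:] = t" for c
    by (simp_all add: specialize_def map_poly_pCons)
  show ?thesis
    unfolding shear_def hom_subst
    by (rule arg_cong3[of _ _ _ _ _ _ mpoly_subst]) (auto simp: * diff power)
qed

lemma unshear: "specialize (mvar 2 + mvar 1 ^ N) (shear N p) = p"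
proof -
  have "(\<lambda>i. if i = 2 then mvar 2 + mvar 1 ^ N - mvar 1 ^ N else mvar i) = (mvar :: nat \<Rightarrow> 'a mpoly)" by auto
  then show ?thesis unfolding specialize_shear by (simp only: mpoly_subst_id)
qed

lemma poly_map_const_poly:
  assumes "comm_ring_hom h"
  shows "poly (map_poly (\<lambda>c. [:h c:]) p) [:q:] = [:poly (map_poly h p) q:]"
  using comm_ring_hom.zero[OF assms] by (induction p) (simp_all add: map_poly_pCons)

lemma poly_map_pCons_0_1:
  assumes "comm_ring_hom h"
  shows "poly (map_poly (\<lambda>c. [:h c:]) p) [:0, 1:] = map_poly h p"
  using comm_ring_hom.zero[OF assms] by (induction p) (simp_all add: map_poly_pCons)

text \<open>The shear sends x_2 + x_1^N to the inner variable y, so the result is p(y), free of the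
  outer variable.\<close>

lemma shear_poly:
  fixes p :: "'a::comm_ring_1 poly"
  shows "shear N (poly (map_poly mconst p) (mvar 2 + mvar 1 ^ N)) = [:map_poly mconst p:]"
proof -
  interpret comm_ring_hom "shear N :: 'a mpoly \<Rightarrow> _" by (rule shear_hom)
  have "shear N (mvar 2 + mvar 1 ^ N :: 'a mpoly) = [:[:0, 1:]:]"
    by (simp add: add power shear_mvar)
  moreover have "map_poly (shear N) (map_poly mconst p) = map_poly (\<lambda>c. [:[:mconst c:]:]) p"
    by (simp add: map_poly_map_poly zero comm_ring_hom.zero[OF comm_ring_hom_mconst] shear_mconst o_def)
  ultimately show ?thesis
    unfolding poly by (simp add: poly_map_const_poly comm_ring_hom_mconst_poly poly_map_pCons_0_1
        comm_ring_hom_mconst)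
qed

text \<open>With X as outer variable the monomial becomes X^e (y - X^N)^k, while \<open>R\<close>
  contributes only in degree 0.\<close>

lemma lead_coeff_shear_power:
  fixes R :: "'a::idom mpoly"
  assumes "N > 0" "e + k > 0" and R: "degree (shear N R) = 0"
  shows "degree (shear N (mvar 1 ^ e * mvar 2 ^ k + R)) = e + N * k"
    and "lead_coeff (shear N (mvar 1 ^ e * mvar 2 ^ k + R)) = (- 1) ^ k"
proof -
  interpret comm_ring_hom "shear N :: 'a mpoly \<Rightarrow> _" by (rule shear_hom)
  let ?u = "[:[:0, 1:]:] - [:0, 1:] ^ N :: 'a mpoly poly poly"
  let ?M = "[:0, 1:] ^ e * ?u ^ k"
  have X: "[:0, 1:] ^ N = monom (1 :: 'a mpoly poly) N" by (simp add: monom_altdef)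
  have deg: "degree ?u = N" using \<open>N > 0\<close> unfolding X
    by (subst diff_conv_add_uminus, subst degree_add_eq_right) (simp_all add: degree_monom_eq)
  then have lead: "lead_coeff ?u = - 1" using \<open>N > 0\<close>
    by (simp add: X) (simp add: coeff_pCons split: nat.splits)
  have "?u \<noteq> 0" using lead by auto
  then have degM: "degree ?M = e + N * k"
    by (simp add: degree_mult_eq degree_power_eq deg)
  have leadM: "lead_coeff ?M = (- 1) ^ k"
    unfolding lead_coeff_mult lead_coeff_power lead by simp
  have sh: "shear N (mvar 1 ^ e * mvar 2 ^ k + R) = ?M + shear N R"
    by (simp add: add mult power shear_mvar)
  have less: "degree (shear N R) < degree ?M"
    using assms by (simp add: degM)
  show "degree (shear N (mvar 1 ^ e * mvar 2 ^ k + R)) = e + N * k"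
    unfolding sh degree_add_eq_left[OF less] by (rule degM)
  show "lead_coeff (shear N (mvar 1 ^ e * mvar 2 ^ k + R)) = (- 1) ^ k"
    unfolding sh degree_add_eq_left[OF less] coeff_add using leadM less by (simp add: coeff_eq_0)
qed

text \<open>The bound on \<open>e\<close> lets the \<open>B\<close>-term determine the leading
  coefficient in x_1, \<open>w\<close> makes \<alpha> a simple root of it, and \<open>roots\<close>
  prevents y - \<beta> from dividing \<open>F\<close> when \<beta> is a root of
  \<open>B\<close>.\<close>

lemma mpoly_absolutely_irreducible:
  fixes V R F G H :: "'l::alg_closed_field mpoly" and B E w :: "'l poly" and N e k :: nat
  defines "T \<equiv> mvar 2 + mvar 1 ^ N"
  assumes F: "F = V * (T - mconst \<alpha>) + poly (map_poly mconst E) T +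
      poly (map_poly mconst B) T * (mvar 1 ^ e * mvar 2 ^ k + R)"
    and N: "N > 0" and e: "e > degree (shear N V)" and R: "degree (shear N R) = 0"
    and B: "B = [:-\<alpha>, 1:] * w" and w: "poly w \<alpha> \<noteq> 0" and E: "poly E \<alpha> \<noteq> 0"
    and roots: "\<And>\<beta>. poly B \<beta> = 0 \<Longrightarrow> specialize (mconst \<beta>) (shear N V) * mconst (\<beta> - \<alpha>) + mconst (poly E \<beta>) \<noteq> 0"
    and FGH: "F = G * H"
  shows "\<exists>c. c \<noteq> 0 \<and> (G = mconst c \<or> H = mconst c)"
proof -
  interpret s: comm_ring_hom "shear N :: 'l mpoly \<Rightarrow> _" by (rule shear_hom)
  interpret m: comm_ring_hom "mconst :: 'l \<Rightarrow> _" by (rule comm_ring_hom_mconst)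
  interpret mm: comm_ring_hom "map_poly (mconst :: 'l \<Rightarrow> _)" by (rule m.map_poly_hom)
  let ?W = "mvar 1 ^ e * mvar 2 ^ k + R"
  let ?B = "map_poly mconst B" and ?E = "map_poly mconst E"
  have peval: "poly (map_poly mconst p) (mconst x) = mconst (poly p x)" for p :: "'l poly" and x
    by (simp add: m.poly)
  have T: "shear N T = [:[:0, 1:]:]"
    by (simp add: T_def s.add s.power shear_mvar)
  have sh_poly: "shear N (poly (map_poly mconst p) T) = [:map_poly mconst p:]" for p :: "'l poly"
    unfolding T_def by (rule shear_poly)
  have f: "shear N F = smult ?B (shear N ?W) + (shear N V * [:[:- mconst \<alpha>, 1:]:] + [:?E:])"
    unfolding F s.add s.mult s.diff T shear_mconst sh_poly by simp
  have f_mult: "shear N F = [:?B:] * shear N ?W + (shear N V * [:[:- mconst \<alpha>, 1:]:] + [:?E:])"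
    using f by simp
  have "w \<noteq> 0" using w by auto
  then have "B \<noteq> 0" unfolding B by (simp del: mult_pCons_left)
  then have nz: "?B \<noteq> 0" by (simp add: map_poly_eq_0_iff mconst_eq_0_iff m.zero)
  have ek: "e + k > 0" using e by simp
  \<comment> \<open>The factor y - \<alpha> and E(y) are constant in the outer variable, so only
    \<open>V\<close> matters for this degree.\<close>
  have "degree (shear N V * [:[:- mconst \<alpha>, 1:]:] + [:?E:]) \<le> degree (shear N V)"
    by (intro degree_add_le order_trans[OF degree_mult_le]) simp_all
  also have "\<dots> < degree (smult ?B (shear N ?W))"
    using e nz by (simp add: lead_coeff_shear_power[OF N ek R])
  finally have less: "degree (shear N V * [:[:- mconst \<alpha>, 1:]:] + [:?E:]) <
      degree (smult ?B (shear N ?W))" .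
  have "lead_coeff (shear N F) = lead_coeff (smult ?B (shear N ?W))"
    unfolding f by (subst (1 2) add.commute) (rule lead_coeff_add_le[OF less])
  also have "\<dots> = ?B * (- 1) ^ k"
    by (simp only: lead_coeff_smult lead_coeff_shear_power(2)[OF N ek R])
  finally have lead: "lead_coeff (shear N F) = ?B * (- 1) ^ k" .
  have linear: "map_poly mconst [:- x, 1:] = [:- mconst x, 1:]" for x :: 'l
    by (simp add: map_poly_pCons m.zero m.one m.minus)
  have "degree (shear N G) = 0 \<or> degree (shear N H) = 0"
  proof (rule reverse_eisenstein)
    show "shear N F = shear N G * shear N H" by (simp add: FGH s.mult)
    show "lead_coeff (shear N F) = [:- mconst \<alpha>, 1:] * (map_poly mconst w * (- 1) ^ k)"
      unfolding lead B mm.mult linear by (simp only: mult_ac)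
    show "poly (map_poly mconst w * (- 1) ^ k) (mconst \<alpha>) \<noteq> 0"
      using w by (simp add: peval mconst_eq_0_iff)
    interpret ev: comm_ring_hom "map_poly (\<lambda>q. poly q (mconst \<alpha> :: 'l mpoly))"
      by (intro comm_ring_hom.map_poly_hom comm_ring_hom_poly)
    \<comment> \<open>At y = \<alpha> the terms with \<open>V\<close> and with \<open>B\<close>
      vanish and only E(\<alpha>) remains.\<close>
    have "map_poly (\<lambda>q. poly q (mconst \<alpha>)) [:[:- mconst \<alpha>, 1:]:] = (0 :: 'l mpoly poly)"
      by (simp add: map_poly_pCons)
    moreover have "map_poly (\<lambda>q. poly q (mconst \<alpha>)) (smult ?B (shear N ?W)) =
        [:mconst (poly B \<alpha>):] * map_poly (\<lambda>q. poly q (mconst \<alpha>)) (shear N ?W)"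
      by (simp add: map_poly_smult peval)
    ultimately show "map_poly (\<lambda>q. poly q (mconst \<alpha>)) (shear N F) = [:mconst (poly E \<alpha>):]"
      unfolding f ev.add ev.mult by (simp add: B peval map_poly_pCons m.zero)
    show "mconst (poly E \<alpha>) \<noteq> 0" using E by (simp add: mconst_eq_0_iff)
  qed
  moreover have "\<exists>c. c \<noteq> 0 \<and> P = mconst c"
    if PQ: "F = P * Q" and P: "degree (shear N P) = 0" for P Q
  proof -
    obtain g where g: "shear N P = [:g:]" using P by (metis degree_eq_zeroE)
    obtain A where A: "B = smult (lead_coeff B) (\<Prod>x\<in>#A. [:-x, 1:])"
      using alg_closed_imp_factorization \<open>B \<noteq> 0\<close> by blast
    have "?B = smult (mconst (lead_coeff B)) (map_poly mconst (\<Prod>x\<in>#A. [:-x, 1:]))"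
      by (subst A) (simp add: map_poly_smult m.zero m.mult)
    also have "map_poly mconst (\<Prod>x\<in>#A. [:-x, 1:]) = (\<Prod>x\<in>#image_mset mconst A. [:-x, 1:])"
      by (induction A) (simp_all add: mm.one mm.mult linear del: mult_pCons_left)
    finally have BA: "?B = smult (mconst (lead_coeff B)) (\<Prod>x\<in>#image_mset mconst A. [:-x, 1:])" .
    have "\<exists>c. g = [:c:] \<and> c dvd 1"
    proof (rule factor_of_linear_factors_without_roots)
      \<comment> \<open>A factor free of the outer variable divides the leading coefficient.\<close>
      have "?B * (- 1) ^ k = g * lead_coeff (shear N Q)"
        using lead unfolding PQ s.mult g lead_coeff_mult by simp
      \<comment> \<open>A second factor (-1)^k removes the sign, because its square is 1.\<close>
      from arg_cong[OF this, of "\<lambda>q. q * (- 1) ^ k"]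
      have "g * (lead_coeff (shear N Q) * (- 1) ^ k) = ?B * ((- 1) ^ k * (- 1) ^ k)"
        unfolding mult.assoc by (rule sym)
      also have "\<dots> = ?B" by (simp flip: power_mult_distrib)
      finally show "g * (lead_coeff (shear N Q) * (- 1) ^ k) =
          smult (mconst (lead_coeff B)) (\<Prod>x\<in>#image_mset mconst A. [:-x, 1:])"
        using BA by simp
      have "mconst (lead_coeff B) * mconst (inverse (lead_coeff B)) = 1"
        using \<open>B \<noteq> 0\<close> by (simp flip: m.mult add: m.one)
      then show "mconst (lead_coeff B) dvd 1" by (metis dvdI)
      show "\<forall>x\<in>#image_mset mconst A. poly g x \<noteq> 0"
      proof
        fix x assume "x \<in># image_mset mconst A"
        then obtain \<beta> where \<beta>: "\<beta> \<in># A" "x = mconst \<beta>" by auto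
        interpret sp: comm_ring_hom "specialize x" by (rule specialize_hom)
        have "poly B \<beta> = 0"
          by (subst A) (use \<beta>(1) in \<open>auto simp: poly_prod_mset prod_mset_zero_iff\<close>)
        \<comment> \<open>This is \<open>F\<close> at y = \<beta>, where the \<open>B\<close>-term
          drops out; \<open>roots\<close> says that the rest is nonzero.\<close>
        moreover from this have "specialize x (shear N F) =
            specialize (mconst \<beta>) (shear N V) * mconst (\<beta> - \<alpha>) + mconst (poly E \<beta>)"
          unfolding f_mult sp.add sp.mult
          by (simp add: specialize_def map_poly_pCons \<beta>(2) peval m.zero m.diff)
        ultimately have "specialize x (shear N F) \<noteq> 0" using roots by simp
        moreover have "specialize x (shear N F) = poly g x * specialize x (shear N Q)"
          unfolding PQ s.mult sp.mult g by (simp add: specialize_def map_poly_pCons)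
        ultimately show "poly g x \<noteq> 0" by auto
      qed
    qed
    then obtain c where c: "g = [:c:]" "c dvd 1" by blast
    \<comment> \<open>Here \<open>g\<close> is constant in y as well, so undoing the shear returns
      its constant term.\<close>
    have "P = c"
      using unshear[of N P] by (simp add: g c(1) specialize_def map_poly_pCons)
    then show ?thesis using mpoly_unit_imp_const c(2) by blast
  qed
  ultimately show ?thesis using FGH by (metis mult.commute)
qed

text \<open>The hypothesis makes V - c divisible by x_2 + x_1^N - \<beta>, whose degree N in x_1
  exceeds that of \<open>V\<close>; so V - c is zero.\<close>

lemma mpoly_eq_const_if_specialize_const:
  fixes V :: "'a::idom mpoly"
  assumes N: "deg_in 1 V < N" and c: "specialize (mconst \<beta>) (shear N V) = mconst c"
  shows "V = mconst c"
proof (rule ccontr)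
  assume neq: "V \<noteq> mconst c"
  let ?T = "mvar 2 + mvar 1 ^ N - mconst \<beta> :: 'a mpoly"
  have "?T dvd mpoly_subst mconst mvar V -
      mpoly_subst mconst (\<lambda>i. if i = 2 then mconst \<beta> - mvar 1 ^ N else mvar i) V"
    by (rule dvd_mpoly_subst_diff) (simp add: algebra_simps)
  then have "?T dvd V - mconst c"
    using c unfolding specialize_shear by (simp add: mpoly_subst_id)
  then obtain Y where Y: "V - mconst c = ?T * Y" by (rule dvdE)
  interpret s: comm_ring_hom "split_var 1 :: 'a mpoly \<Rightarrow> _" by (rule split_var_hom)
  have "split_var 1 ?T = monom 1 N + [:mvar 2 - mconst \<beta>:]"
    by (simp add: s.add s.diff s.power split_var_mvar split_var_mconst monom_altdef)
  then have T: "deg_in 1 ?T = N"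
    using N by (simp add: deg_in_eq_degree degree_add_eq_left degree_monom_eq)
  have "V - mconst c \<noteq> 0" using neq by simp
  then have "N \<le> deg_in 1 (V - mconst c)"
    unfolding Y using T by (subst deg_in_mult) auto
  also have "\<dots> \<le> deg_in 1 V"
    unfolding deg_in_eq_degree s.diff split_var_mconst
    by (intro degree_diff_le) simp_all
  finally show False using N by simp
qed

subsection \<open>Irreducibility and reducibility in the polynomial rings\<close>

lemma carrier_mpoly_ring_UNIV:
  "p \<in> carrier (mpoly_ring n UNIV) \<longleftrightarrow> (\<forall>m\<in>Poly_Mapping.keys p. Poly_Mapping.keys m \<subseteq> {1..n})"
  by (simp add: mpoly_ring_def ring_of_type_algebra_def)

lemma mpoly_ring_simps:
  "x \<otimes>\<^bsub>mpoly_ring n K\<^esub> y = x * y" "\<one>\<^bsub>mpoly_ring n K\<^esub> = 1" "\<zero>\<^bsub>mpoly_ring n K\<^esub> = 0"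
  by (simp_all add: mpoly_ring_def ring_of_type_algebra_def)

lemma mconst_carrier: "c \<in> K \<Longrightarrow> 0 \<in> K \<Longrightarrow> mconst c \<in> carrier (mpoly_ring n K)"
  by (auto simp: mpoly_ring_def ring_of_type_algebra_def mconst_def lookup_single when_def
      split: if_splits)

lemma mvar_carrier: "i \<in> {1..n} \<Longrightarrow> mvar i \<in> carrier (mpoly_ring n UNIV)"
  by (auto simp: carrier_mpoly_ring_UNIV mvar_def split: if_splits)

lemma add_carrier:
  "p \<in> carrier (mpoly_ring n UNIV) \<Longrightarrow> q \<in> carrier (mpoly_ring n UNIV) \<Longrightarrow>
   p + q \<in> carrier (mpoly_ring n UNIV)"
  using keys_add[of p q] unfolding carrier_mpoly_ring_UNIV by blast

lemma mult_carrier: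
  assumes "p \<in> carrier (mpoly_ring n UNIV)" "q \<in> carrier (mpoly_ring n UNIV)"
  shows "p * q \<in> carrier (mpoly_ring n UNIV)"
  unfolding carrier_mpoly_ring_UNIV
proof
  fix m assume "m \<in> Poly_Mapping.keys (p * q)"
  then obtain a b where ab: "m = a + b" "a \<in> Poly_Mapping.keys p" "b \<in> Poly_Mapping.keys q"
    using keys_mult[of p q] by blast
  then show "Poly_Mapping.keys m \<subseteq> {1..n}"
    using keys_add[of a b] assms unfolding carrier_mpoly_ring_UNIV by blast
qed

lemma power_carrier: "p \<in> carrier (mpoly_ring n UNIV) \<Longrightarrow> p ^ k \<in> carrier (mpoly_ring n UNIV)"
  by (induction k) (auto intro: mult_carrier simp: carrier_mpoly_ring_UNIV[of 1])

lemma sum_carrier: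
  "(\<And>i. i \<in> A \<Longrightarrow> u i \<in> carrier (mpoly_ring n UNIV)) \<Longrightarrow> sum u A \<in> carrier (mpoly_ring n UNIV)"
  by (induction A rule: infinite_finite_induct) (simp_all add: add_carrier carrier_mpoly_ring_UNIV[of 0])

lemma poly_carrier:
  assumes "q \<in> carrier (mpoly_ring n UNIV)"
  shows "poly (map_poly mconst p) q \<in> carrier (mpoly_ring n UNIV)"
  by (induction p)
    (simp_all add: map_poly_pCons add_carrier mult_carrier mconst_carrier assms
      carrier_mpoly_ring_UNIV[of 0] comm_ring_hom.zero[OF comm_ring_hom_mconst])

text \<open>A positive degree keeps \<open>p\<close> from being a unit, and the strictly larger
  degree of the product makes \<open>p\<close> a proper factor.\<close>

lemma ring_reducible_mult:
  fixes p q :: "'a::idom mpoly"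
  assumes "p \<in> carrier (mpoly_ring n UNIV)" "q \<in> carrier (mpoly_ring n UNIV)"
    and "0 < deg_in i p" "deg_in i p < deg_in i (p * q)"
  shows "ring_reducible (mpoly_ring n UNIV) (p * q)"
proof -
  let ?R = "mpoly_ring n UNIV :: 'a mpoly ring"
  have units: "deg_in i r = 0" if "r \<in> Units ?R" for r
  proof -
    have "r dvd 1" using that unfolding Units_def mpoly_ring_simps by (auto intro: dvdI[OF sym])
    then show ?thesis using mpoly_unit_imp_const deg_in_mconst by metis
  qed
  have "p * q \<noteq> 0" using assms(4) by (auto simp: deg_in_def[of _ 0])
  have "\<not> p * q divides\<^bsub>?R\<^esub> p"
  proof
    assume "p * q divides\<^bsub>?R\<^esub> p"
    then obtain r where r: "p = p * q * r" unfolding factor_def mpoly_ring_simps by blast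
    then have "r \<noteq> 0" using \<open>p * q \<noteq> 0\<close> by auto
    then have "deg_in i p = deg_in i (p * q) + deg_in i r"
      by (subst r) (rule deg_in_mult[OF \<open>p * q \<noteq> 0\<close>])
    then show False using assms(4) by simp
  qed
  moreover have "p divides\<^bsub>?R\<^esub> p * q"
    unfolding factor_def mpoly_ring_simps using assms(2) by blast
  ultimately have "properfactor ?R p (p * q)" unfolding properfactor_def by blast
  moreover have "p \<notin> Units ?R" "p * q \<notin> Units ?R" using units assms(3,4) by fastforce+
  ultimately show ?thesis
    using assms(1,2) \<open>p * q \<noteq> 0\<close>
    unfolding ring_reducible_def ring_irreducible_def Divisibility.irreducible_def mpoly_ring_simps
    by (auto intro: mult_carrier)
qed

text \<open>A factorization over \<open>K\<close> has a constant factor by \<open>irr\<close>. Its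
  inverse lies in \<open>K\<close> again, so the constant is a unit of the smaller ring.\<close>

lemma ring_irreducible_if_absolutely_irreducible:
  fixes F :: "'a::field mpoly"
  assumes K: "0 \<in> K" "\<And>c. c \<in> K \<Longrightarrow> c \<noteq> 0 \<Longrightarrow> inverse c \<in> K"
    and deg: "deg_in i F > 0"
    and irr: "\<And>G H. F = G * H \<Longrightarrow> \<exists>c. c \<noteq> 0 \<and> (G = mconst c \<or> H = mconst c)"
  shows "ring_irreducible\<^bsub>mpoly_ring n K\<^esub> F"
proof -
  let ?R = "mpoly_ring n K"
  interpret m: comm_ring_hom "mconst :: 'a \<Rightarrow> _" by (rule comm_ring_hom_mconst)
  have inv: "mconst c * mconst (inverse c) = 1" if "c \<noteq> 0" for c :: 'a
    using that by (simp flip: m.mult add: m.one)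
  have const: "mconst (inverse c) \<in> carrier ?R" if "mconst c \<in> carrier ?R" "c \<noteq> 0" for c
  proof -
    have "\<forall>m. Poly_Mapping.lookup (mconst c) m \<in> K"
      using that(1) by (simp add: mpoly_ring_def ring_of_type_algebra_def)
    then have "c \<in> K" by (metis mconst_def lookup_single_eq)
    then show ?thesis using K that(2) by (intro mconst_carrier) auto
  qed
  have "F \<noteq> 0" using deg by (auto simp: deg_in_def)
  moreover have "F \<notin> Units ?R"
  proof
    assume "F \<in> Units ?R"
    then have "F dvd 1" unfolding Units_def mpoly_ring_simps by (auto intro: dvdI[OF sym])
    then show False using mpoly_unit_imp_const deg_in_mconst deg by (metis less_irrefl)
  qed
  moreover have "b \<in> Units ?R" if b: "b \<in> carrier ?R" "properfactor ?R b F" for b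
  proof -
    obtain c where c: "c \<in> carrier ?R" "F = b * c" and ndvd: "\<not> F divides\<^bsub>?R\<^esub> b"
      using b(2) unfolding properfactor_def factor_def mpoly_ring_simps by blast
    obtain u where u: "u \<noteq> 0" "b = mconst u \<or> c = mconst u" using irr[OF c(2)] by blast
    show ?thesis
    proof (cases "b = mconst u")
      case True
      then show ?thesis
        using b(1) const[of u] u(1) inv[OF u(1)] unfolding Units_def mpoly_ring_simps
        by (auto intro!: bexI[of _ "mconst (inverse u)"] simp: mult.commute)
    next
      case False
      then have cu: "c = mconst u" using u by blast
      have "b = F * mconst (inverse u)"
        unfolding c(2) cu mult.assoc inv[OF u(1)] by simp
      moreover have "mconst (inverse u) \<in> carrier ?R" using const c(1) u(1) cu by blast
      ultimately have "F divides\<^bsub>?R\<^esub> b" unfolding factor_def mpoly_ring_simps by blast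
      then show ?thesis using ndvd by blast
    qed
  qed
  ultimately show ?thesis
    unfolding ring_irreducible_def Divisibility.irreducible_def mpoly_ring_simps by blast
qed

lemma simple_ext_zero: "0 \<in> simple_ext a"
  and simple_ext_inverse: "c \<in> simple_ext a \<Longrightarrow> c \<noteq> 0 \<Longrightarrow> inverse c \<in> simple_ext a"
proof -
  let ?L = "ring_of_type_algebra :: 'a alg_closure ring"
  interpret L: Ring.field ?L by (rule field_from_type_algebra)
  show "0 \<in> simple_ext a"
    unfolding simple_ext_def using L.zero_in_generate by (simp add: ring_of_type_algebra_def)
  assume c: "c \<in> simple_ext a" "c \<noteq> 0"
  \<comment> \<open>Identifies the inverse of the ring record with that of the type class.\<close>
  have "inv\<^bsub>?L\<^esub> c = inverse c"
    using c(2) by (intro L.comm_inv_char) (simp_all add: ring_of_type_algebra_def)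
  moreover have "inv\<^bsub>?L\<^esub> c \<in> simple_ext a"
    using c unfolding simple_ext_def
    by (intro generate_field.m_inv) (simp_all add: ring_of_type_algebra_def)
  ultimately show "inverse c \<in> simple_ext a" by simp
qed

subsection \<open>Choice of the polynomial\<close>

text \<open>In a polynomial relation for \<open>t\<close>, powers of \<open>t\<close> are cancelled
  until the constant term is nonzero; solving for that term gives the inverse.\<close>

lemma inverse_as_poly:
  fixes t :: "'k::field alg_closure"
  assumes "t \<noteq> 0"
  shows "\<exists>g. t * poly (map_poly to_ac g) t = 1"
proof -
  obtain p where "p \<noteq> 0" "poly (map_poly to_ac p) t = 0" by (rule alg_closure_algebraic)
  then show ?thesis
  proof (induction p)
    case (pCons a p)
    show ?case
    proof (cases "a = 0")
      case True
      then show ?thesis using pCons assms by (auto simp: map_poly_pCons)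
    next
      case False
      have "t * poly (map_poly to_ac p) t = - to_ac a"
        using pCons.prems by (simp add: map_poly_pCons eq_neg_iff_add_eq_0 add.commute)
      then have "t * poly (map_poly to_ac (smult (inverse (- a)) p)) t = 1"
        using False by (simp only: map_poly_smult to_ac_0 to_ac_mult poly_smult mult.left_commute[of t])
          (simp add: field_simps)
      then show ?thesis by blast
    qed
  qed simp
qed

lemma rsquarefree_root_decomp:
  assumes "rsquarefree p" "poly p a = 0"
  shows "\<exists>w. p = [:-a, 1:] * w \<and> poly w a \<noteq> 0"
proof -
  have p: "p \<noteq> 0" "order a p = 0 \<or> order a p = 1" using assms(1) by (auto simp: rsquarefree_def)
  then have "order a p = 1" using assms(2) by (simp add: order_root)
  then show ?thesis using order_decomp[OF p(1), of a] by (auto simp: poly_eq_0_iff_dvd)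
qed

text \<open>When \<open>V\<close> is constant, the factor \<open>C\<close> forces \<open>U - a\<^sub>0 V\<close> to be a fixed nonzero constant
  modulo \<open>T - \<beta>\<close> for every conjugate \<open>\<beta>\<close> of \<open>a\<^sub>0\<close>: with \<open>C = 1\<close> it could vanish there.\<close>

lemma exists_cofactor:
  fixes V :: "'k::field mpoly" and P m :: "'k poly"
  assumes V: "V \<noteq> 0" and N: "deg_in 1 V < N"
    and P: "poly (map_poly to_ac P) \<alpha> \<noteq> 0" and m: "is_min_poly m \<alpha>"
  shows "\<exists>C. poly (map_poly to_ac (P * C)) \<alpha> \<noteq> 0 \<and>
    (\<forall>\<beta>. poly (map_poly to_ac m) \<beta> = 0 \<longrightarrow>
      specialize (mconst \<beta>) (shear N (mpoly_to_ac V)) * mconst (\<beta> - \<alpha>) +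
      mconst (poly (map_poly to_ac (P * C)) \<beta>) \<noteq> 0)"
proof -
  interpret ac: comm_ring_hom "map_poly to_ac :: 'k poly \<Rightarrow> _"
    by (intro comm_ring_hom.map_poly_hom comm_ring_hom_to_ac)
  interpret m: comm_ring_hom "mconst :: 'k alg_closure \<Rightarrow> _" by (rule comm_ring_hom_mconst)
  show ?thesis
  proof (cases "\<exists>c. V = mconst c")
    case True
    then obtain c where c: "V = mconst c" "c \<noteq> 0" using V by (auto simp: mconst_eq_0_iff)
    \<comment> \<open>Any element of the ground field different from \<alpha> would do.\<close>
    define e :: 'k where "e = (if \<alpha> = 0 then 1 else 0)"
    have e: "to_ac e \<noteq> \<alpha>" by (simp add: e_def)
    define t where "t = poly (map_poly to_ac P) \<alpha>"
    obtain g where g: "t * poly (map_poly to_ac g) t = 1"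
      using inverse_as_poly P unfolding t_def by blast
    \<comment> \<open>As g(P(\<alpha>)) inverts P(\<alpha>), this choice gives P C the value c (e -
      \<alpha>) at \<alpha>.\<close>
    define C where "C = smult c (pcompose g P * [:e, -1:])"
    interpret ev: comm_ring_hom "\<lambda>p. poly (map_poly to_ac p) \<alpha>"
      by (rule comm_ring_hom.comp[OF ac.comm_ring_hom_axioms comm_ring_hom_poly])
    have "poly (map_poly to_ac (pcompose g P)) \<alpha> = poly (map_poly to_ac g) t"
      unfolding pcompose_altdef ev.poly t_def
      by (simp add: map_poly_map_poly ev.zero map_poly_pCons o_def)
    then have C: "poly (map_poly to_ac (P * C)) \<alpha> = to_ac c * (to_ac e - \<alpha>)"
      using g by (simp add: C_def ac.mult map_poly_smult map_poly_pCons t_def mult_ac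
          del: mult_pCons_left mult_pCons_right)
    have "poly (map_poly to_ac (P * C - smult c [:e, -1:])) \<alpha> = 0"
      by (simp add: ac.diff C map_poly_smult map_poly_pCons) (simp add: algebra_simps)
    \<comment> \<open>Minimality of \<open>m\<close> carries the value at \<alpha> over to every
      conjugate \<beta>.\<close>
    then have "m dvd P * C - smult c [:e, -1:]" using m unfolding is_min_poly_def by blast
    then obtain q where q: "P * C - smult c [:e, -1:] = m * q" by (rule dvdE)
    have root: "poly (map_poly to_ac (P * C)) \<beta> = to_ac c * (to_ac e - \<beta>)"
      if "poly (map_poly to_ac m) \<beta> = 0" for \<beta>
    proof -
      have "poly (map_poly to_ac (P * C - smult c [:e, -1:])) \<beta> = 0"
        unfolding q ac.mult using that by simp
      then show ?thesis
        by (simp add: ac.diff map_poly_smult map_poly_pCons) (simp add: algebra_simps)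
    qed
    have spec: "specialize (mconst \<beta>) (shear N (mpoly_to_ac V)) = mconst (to_ac c)" for \<beta>
      by (simp add: c(1) mpoly_to_ac_mconst shear_mconst specialize_def map_poly_pCons)
    \<comment> \<open>The identity c (\<beta> - \<alpha>) + c (e - \<beta>) = c (e - \<alpha>) makes
      the sum independent of \<beta>.\<close>
    have "specialize (mconst \<beta>) (shear N (mpoly_to_ac V)) * mconst (\<beta> - \<alpha>) +
        mconst (poly (map_poly to_ac (P * C)) \<beta>) = mconst (to_ac c * (to_ac e - \<alpha>))"
      if "poly (map_poly to_ac m) \<beta> = 0" for \<beta>
      unfolding root[OF that] spec m.mult[symmetric] m.add[symmetric]
      by (rule arg_cong[of _ _ mconst]) (simp add: algebra_simps)
    then show ?thesis
      using C c(2) e by (intro exI[of _ C]) (simp add: mconst_eq_0_iff)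
  next
    case False
    have notconst: "mpoly_to_ac V \<noteq> mconst c" for c
    proof
      assume eq: "mpoly_to_ac V = mconst c"
      have "Poly_Mapping.lookup V k = 0" if "k \<noteq> 0" for k
        using arg_cong[OF eq, of "\<lambda>p. Poly_Mapping.lookup p k"] that
        by (simp add: lookup_mpoly_to_ac mconst_def lookup_single)
      then have "V = mconst (Poly_Mapping.lookup V 0)"
        by (intro poly_mapping_eqI) (simp add: mconst_def lookup_single when_def)
      then show False using False by blast
    qed
    have N': "deg_in 1 (mpoly_to_ac V) < N"
      using N by (simp add: deg_in_def keys_mpoly_to_ac)
    \<comment> \<open>For nonconstant \<open>V\<close> the choice C = 1 works: vanishing at \<beta>
      different from \<alpha> would make the specialization of \<open>V\<close> constant, and so
      \<open>V\<close> itself.\<close>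
    have "specialize (mconst \<beta>) (shear N (mpoly_to_ac V)) * mconst (\<beta> - \<alpha>) +
        mconst (poly (map_poly to_ac P) \<beta>) \<noteq> 0" for \<beta>
    proof (cases "\<beta> = \<alpha>")
      case True
      then show ?thesis using P by (simp add: m.zero mconst_eq_0_iff)
    next
      case neq: False
      show ?thesis
      proof
        let ?s = "specialize (mconst \<beta>) (shear N (mpoly_to_ac V))"
        assume "?s * mconst (\<beta> - \<alpha>) + mconst (poly (map_poly to_ac P) \<beta>) = 0"
        then have "?s * mconst (\<beta> - \<alpha>) * mconst (inverse (\<beta> - \<alpha>)) =
            mconst (- poly (map_poly to_ac P) \<beta>) * mconst (inverse (\<beta> - \<alpha>))"
          by (simp only: m.minus flip: eq_neg_iff_add_eq_0)
        moreover have "mconst (\<beta> - \<alpha>) * mconst (inverse (\<beta> - \<alpha>)) = 1"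
          using neq by (simp flip: m.mult add: m.one)
        ultimately have "?s = mconst (- poly (map_poly to_ac P) \<beta> * inverse (\<beta> - \<alpha>))"
          by (simp only: mult.assoc mult_1_right m.mult)
        then show False using mpoly_eq_const_if_specialize_const[OF N'] notconst by blast
      qed
    qed
    then show ?thesis using P by (intro exI[of _ 1]) simp
  qed
qed

theorem corollary1p6:
  fixes n :: nat
    and S :: "'k::field set"
    and a\<^sub>0 :: "'k alg_closure"
    and V :: "'k mpoly"
  assumes "n \<ge> 2"
    and "finite S"
    and "a\<^sub>0 \<notin> to_ac ` S"
    and "separable_elem a\<^sub>0"
    and "V \<in> carrier (mpoly_ring n UNIV)"
    and "V \<noteq> 0"
  shows "\<exists>d\<^sub>0::nat. \<forall>d::nat \<Rightarrow> nat. (\<forall>i\<in>{1..n}. d i > d\<^sub>0) \<longrightarrow>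
    (\<exists>U \<in> carrier (mpoly_ring n UNIV).
       (\<forall>a\<in>S. ring_reducible (mpoly_ring n UNIV) (U - mconst a * V)) \<and>
       ring_irreducible\<^bsub>mpoly_ring n (simple_ext a\<^sub>0)\<^esub>
         (mpoly_to_ac U - mconst a\<^sub>0 * mpoly_to_ac V) \<and>
       total_deg (mpoly_to_ac U - mconst a\<^sub>0 * mpoly_to_ac V) = max (total_deg U) (total_deg V) \<and>
       (\<forall>i\<in>{1..n}. deg_in i U = d i))"
proof -
  interpret ac: comm_ring_hom "map_poly to_ac :: 'k poly \<Rightarrow> _"
    by (intro comm_ring_hom.map_poly_hom comm_ring_hom_to_ac)
  interpret L: comm_ring_hom "mpoly_to_ac :: 'k mpoly \<Rightarrow> _" by (rule mpoly_to_ac_hom)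
  interpret mk: comm_ring_hom "mconst :: 'k \<Rightarrow> _" by (rule comm_ring_hom_mconst)
  interpret ml: comm_ring_hom "mconst :: 'k alg_closure \<Rightarrow> _" by (rule comm_ring_hom_mconst)
  interpret mp: comm_ring_hom "map_poly (mconst :: 'k \<Rightarrow> _)" by (rule mk.map_poly_hom)
  define V' where "V' = mpoly_to_ac V"
  define N where "N = Suc (deg_in 1 V)"
  have deg_V': "deg_in 1 V' < N"
    by (simp add: V'_def N_def deg_in_def keys_mpoly_to_ac)
  have "V' \<noteq> 0"
    using assms(6) by (metis V'_def lookup_mpoly_to_ac lookup_zero poly_mapping_eqI to_ac_eq_0_iff)
  define T :: "'k mpoly" where "T = mvar 2 + mvar 1 ^ N"
  define at_T where "at_T p = poly (map_poly mconst p) T" for p :: "'k poly"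
  define P where "P = (\<Prod>a\<in>S. [:-a, 1:])"
  obtain m where m: "is_min_poly m a\<^sub>0" "rsquarefree (map_poly to_ac m)"
    using assms(4) unfolding separable_elem_def by blast
  define B where "B = P * m"
  have P_ac: "map_poly to_ac P = (\<Prod>a\<in>S. [:- to_ac a, 1:])"
    by (simp add: P_def ac.prod map_poly_pCons)
  then have P_root: "poly (map_poly to_ac P) \<beta> = 0 \<longleftrightarrow> \<beta> \<in> to_ac ` S" for \<beta>
    using assms(2) by (auto simp: poly_prod)
  have P_neq_0: "poly (map_poly to_ac P) a\<^sub>0 \<noteq> 0" using P_root assms(3) by simp
  obtain C where C: "poly (map_poly to_ac (P * C)) a\<^sub>0 \<noteq> 0"
    "\<And>\<beta>. poly (map_poly to_ac m) \<beta> = 0 \<Longrightarrow> specialize (mconst \<beta>) (shear N V') *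
      mconst (\<beta> - a\<^sub>0) + mconst (poly (map_poly to_ac (P * C)) \<beta>) \<noteq> 0"
    using exists_cofactor[OF assms(6) _ P_neq_0 m(1), of N] unfolding N_def V'_def by auto
  define E where "E = P * C"
  \<comment> \<open>The part of \<open>U\<close> that does not depend on the prescribed
    degrees.\<close>
  define A where "A = V * T + at_T E"
  have at_T_mult: "at_T (p * q) = at_T p * at_T q" for p q
    by (simp add: at_T_def mp.mult)
  have T_carrier: "T \<in> carrier (mpoly_ring n UNIV)"
    using assms(1) unfolding T_def by (intro add_carrier power_carrier mvar_carrier) auto
  have at_T_carrier: "at_T p \<in> carrier (mpoly_ring n UNIV)" for p
    unfolding at_T_def by (rule poly_carrier[OF T_carrier])
  have "N > 0" by (simp add: N_def)
  have deg_T: "deg_in i T = (if i = 1 then N else if i = 2 then 1 else 0)" for i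
  proof -
    have m2: "deg_in i (mvar 2 :: 'k mpoly) = (if i = 2 then 1 else 0)"
      using deg_in_mvar_power[of i 2 1, where 'a = 'k] by simp
    consider "i = 1" | "i = 2" | "i \<noteq> 1" "i \<noteq> 2" by blast
    then show ?thesis
    proof cases
      case 1
      then show ?thesis
        using \<open>N > 0\<close> m2 unfolding T_def
        by (subst add.commute, subst deg_in_add_left) (simp_all add: deg_in_mvar_power)
    next
      case 2
      then show ?thesis
        using m2 unfolding T_def by (subst deg_in_add_left) (simp_all add: deg_in_mvar_power)
    next
      case 3
      then show ?thesis
        using m2 deg_in_add_le[of i "mvar 2 :: 'k mpoly" 0 "mvar 1 ^ N"]
        by (simp add: T_def deg_in_mvar_power)
    qed
  qed
  define \<delta> where "\<delta> i = deg_in i (at_T B)" for i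
  have "map_poly to_ac m \<noteq> 0" using m(2) by (simp add: rsquarefree_def)
  then have "B \<noteq> 0" using P_neq_0 by (auto simp: B_def)
  have at_T_B: "at_T B \<noteq> 0"
  proof
    assume "at_T B = 0"
    \<comment> \<open>The shear sends B(T) to B(y), so T satisfies no nontrivial polynomial
      relation.\<close>
    then have "map_poly mconst B = (0 :: 'k mpoly poly)"
      using shear_poly[of N B] comm_ring_hom.zero[OF shear_hom[of N, where 'a = 'k]]
      by (simp add: at_T_def T_def)
    then show False using \<open>B \<noteq> 0\<close> by (simp add: map_poly_eq_0_iff mconst_eq_0_iff)
  qed
  \<comment> \<open>The summands let B(T) W dominate \<open>A\<close> in each variable and
    \<open>U\<close> dominate \<open>V\<close>, make the cofactor of T - a nonconstant, put
    \<open>e 1\<close> above the sheared degree of \<open>V'\<close>, and keep all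
    \<open>e i\<close> positive.\<close>
  define d\<^sub>0 where "d\<^sub>0 = total_deg A + total_deg V + N + degree (shear N V') + \<delta> 1 + \<delta> 2"
  show ?thesis
  proof (intro exI[of _ d\<^sub>0] allI impI)
    fix d :: "nat \<Rightarrow> nat"
    assume d: "\<forall>i\<in>{1..n}. d i > d\<^sub>0"
    \<comment> \<open>The exponents left for \<open>W\<close> once B(T) has contributed its
      degree.\<close>
    define e where "e i = d i - \<delta> i" for i
    define R :: "nat set \<Rightarrow> 'k mpoly" where "R J = (\<Sum>i\<in>J. mvar i ^ e i)" for J
    define W where "W = mvar 1 ^ e 1 * mvar 2 ^ e 2 + R {3..n}"
    define U where "U = A + at_T B * W"
    have \<delta>: "\<delta> i = 0" if "i \<ge> 3" for i
      using that by (simp add: \<delta>_def at_T_def deg_in_poly deg_T)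
    have d_pos: "d i > d\<^sub>0" if "i \<in> {1..n}" for i using d that by blast
    have e_pos: "e i > 0" "d i = \<delta> i + e i" if i: "i \<in> {1..n}" for i
    proof -
      have "\<delta> i \<le> d\<^sub>0"
        using i \<delta>[of i] by (cases "i = 1 \<or> i = 2") (auto simp: d\<^sub>0_def)
      then show "e i > 0" "d i = \<delta> i + e i" using d_pos[OF i] by (simp_all add: e_def)
    qed
    have W_carrier: "W \<in> carrier (mpoly_ring n UNIV)"
      using assms(1) unfolding W_def R_def
      by (intro add_carrier mult_carrier sum_carrier power_carrier mvar_carrier) auto
    have A_carrier: "A \<in> carrier (mpoly_ring n UNIV)"
      unfolding A_def by (intro add_carrier mult_carrier assms(5) T_carrier at_T_carrier)
    have U_carrier: "U \<in> carrier (mpoly_ring n UNIV)"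
      unfolding U_def by (intro add_carrier mult_carrier A_carrier W_carrier at_T_carrier)
    have deg_12: "deg_in i (mvar 1 ^ e 1 * mvar 2 ^ e 2 :: 'k mpoly) =
        (if i = 1 then e 1 else if i = 2 then e 2 else 0)" for i
      by (simp add: deg_in_mult[OF mvar_power_neq_0 mvar_power_neq_0] deg_in_mvar_power)
    have deg_R: "deg_in i (R J) = 0" if "i \<notin> J" for i J
    proof -
      have "deg_in i (R J) \<le> 0"
        unfolding R_def using that by (intro deg_in_sum_le) (auto simp: deg_in_mvar_power)
      then show ?thesis by simp
    qed
    have deg_W: "deg_in i W = e i" if i: "i \<in> {1..n}" for i
    proof (cases "i \<ge> 3")
      case False
      then have "i = 1 \<or> i = 2" using i by auto
      then show ?thesis
        using False e_pos(1)[OF i] unfolding W_def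
        by (subst deg_in_add_left) (auto simp: deg_12 deg_R)
    next
      case True
      \<comment> \<open>For i >= 3 only this one summand of \<open>W\<close> involves x_i.\<close>
      then have "R {3..n} = mvar i ^ e i + R ({3..n} - {i})"
        using i unfolding R_def by (intro sum.remove) auto
      then have W: "W = mvar i ^ e i + (mvar 1 ^ e 1 * mvar 2 ^ e 2 + R ({3..n} - {i}))"
        by (simp add: W_def algebra_simps)
      have "deg_in i (mvar 1 ^ e 1 * mvar 2 ^ e 2 + R ({3..n} - {i})) \<le> 0"
        using True by (intro deg_in_add_le) (simp_all add: deg_12 deg_R)
      then show ?thesis
        unfolding W using e_pos(1)[OF i] by (subst deg_in_add_left) (auto simp: deg_in_mvar_power)
    qed
    have "W \<noteq> 0" using deg_W[of 1] e_pos(1)[of 1] assms(1) by (auto simp: deg_in_def)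
    have deg_U: "deg_in i U = d i" if i: "i \<in> {1..n}" for i
    proof -
      have BW: "deg_in i (at_T B * W) = d i"
        using e_pos(2)[OF i] deg_W[OF i]
        by (simp add: deg_in_mult[OF at_T_B \<open>W \<noteq> 0\<close>] \<delta>_def)
      have "deg_in i A < d i"
        using deg_in_le_total_deg[of i A] d_pos[OF i] by (simp add: d\<^sub>0_def)
      then show ?thesis
        unfolding U_def by (subst add.commute, subst deg_in_add_left) (simp_all add: BW)
    qed
    have one_in: "1 \<in> {1..n}" using assms(1) by simp
    have total_V: "total_deg V < d 1" using d_pos[OF one_in] by (simp add: d\<^sub>0_def)
    \<comment> \<open>The x_1-degree alone puts \<open>U\<close> above \<open>V\<close>, so the
      maximum is the total degree of \<open>U\<close> and subtracting a multiple of \<open>V\<close>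
      does not change it.\<close>
    then have total: "total_deg V < total_deg U"
      using deg_U[OF one_in] deg_in_le_total_deg[of 1 U] by simp
    have reducible: "ring_reducible (mpoly_ring n UNIV) (U - mconst a * V)" if a: "a \<in> S" for a
    proof -
      define Q where "Q = (\<Prod>a\<in>S - {a}. [:-a, 1:])"
      have "P = [:-a, 1:] * Q"
        unfolding P_def Q_def using assms(2) a by (rule prod.remove)
      moreover have "at_T [:-a, 1:] = T - mconst a"
        by (simp add: at_T_def map_poly_pCons mk.zero mk.one mk.minus)
      ultimately have P: "at_T P = (T - mconst a) * at_T Q"
        by (simp only: at_T_mult)
      \<comment> \<open>The cofactor of T - a: V T - a V equals V (T - a), and P(T) contains T -
        a.\<close>
      define Y where "Y = V + at_T (Q * C) + at_T (Q * m) * W"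
      have UY: "U - mconst a * V = (T - mconst a) * Y"
        unfolding U_def A_def E_def B_def Y_def at_T_mult P by (simp add: algebra_simps)
      have Ta: "T - mconst a = T + mconst (- a)" by (simp add: mk.minus)
      have deg_Ta: "deg_in 1 (T - mconst a) = N"
        unfolding Ta by (subst deg_in_add_left) (simp_all add: deg_in_mconst deg_T N_def)
      have "deg_in 1 (mconst (- a) * V) < d 1"
        using total_V total_deg_const_mult_le[of "- a" V] deg_in_le_total_deg[of 1 "mconst (- a) * V"]
        by linarith
      then have "deg_in 1 (U + mconst (- a) * V) = d 1"
        using deg_U[OF one_in] by (simp only: deg_in_add_left)
      moreover have "U + mconst (- a) * V = U - mconst a * V" by (simp add: mk.minus)
      ultimately have "deg_in 1 ((T - mconst a) * Y) = d 1"
        unfolding UY[symmetric] by (simp only:)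
      moreover have "N < d 1" using d_pos[OF one_in] by (simp add: d\<^sub>0_def)
      ultimately show ?thesis
        unfolding UY using deg_Ta T_carrier W_carrier at_T_carrier assms(5)
        by (intro ring_reducible_mult[where i = 1])
          (simp_all add: Ta Y_def N_def add_carrier mult_carrier mconst_carrier)
    qed
    define F where "F = mpoly_to_ac U - mconst a\<^sub>0 * mpoly_to_ac V"
    have F_add: "F = mpoly_to_ac U + mconst (- a\<^sub>0) * V'"
      by (simp add: F_def V'_def ml.minus)
    have total_ac: "total_deg (mpoly_to_ac p) = total_deg p" for p :: "'k mpoly"
      by (simp add: total_deg_def keys_mpoly_to_ac)
    have total_F: "total_deg F = max (total_deg U) (total_deg V)"
    proof -
      have "total_deg (mconst (- a\<^sub>0) * V') < total_deg (mpoly_to_ac U)"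
        using total_deg_const_mult_le[of "- a\<^sub>0" V'] total by (simp add: total_ac V'_def)
      then show ?thesis
        using total by (simp add: F_add total_deg_add_left total_ac)
    qed
    have "deg_in 1 (mconst (- a\<^sub>0) * V') < deg_in 1 (mpoly_to_ac U)"
    proof -
      have "deg_in 1 (mpoly_to_ac U) = d 1"
        using deg_U[OF one_in] by (simp add: deg_in_def keys_mpoly_to_ac)
      moreover have "deg_in 1 (mconst (- a\<^sub>0) * V') \<le> total_deg V"
        using deg_in_le_total_deg total_deg_const_mult_le[of "- a\<^sub>0" V'] order_trans
        by (metis total_ac V'_def)
      ultimately show ?thesis using total_V by simp
    qed
    then have "deg_in 1 F = d 1"
      using deg_U[OF one_in]
      by (simp add: F_add deg_in_add_left) (simp add: deg_in_def keys_mpoly_to_ac)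
    then have deg_F: "deg_in 1 F > 0" using total_V by simp
    have irr: "\<exists>c. c \<noteq> 0 \<and> (G = mconst c \<or> H = mconst c)" if FGH: "F = G * H" for G H
    proof -
      \<comment> \<open>Separability enters here: \<open>a\<^sub>0\<close> is a simple root of its
        minimal polynomial.\<close>
      obtain w where w: "map_poly to_ac m = [:-a\<^sub>0, 1:] * w" "poly w a\<^sub>0 \<noteq> 0"
        using rsquarefree_root_decomp[OF m(2)] m(1) unfolding is_min_poly_def by blast
      let ?T = "mvar 2 + mvar 1 ^ N :: 'k alg_closure mpoly"
      have T_ac: "mpoly_to_ac T = ?T"
        by (simp add: T_def L.add L.power mpoly_to_ac_mvar)
      have at_T_ac: "mpoly_to_ac (at_T p) = poly (map_poly mconst (map_poly to_ac p)) ?T" for p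
        by (simp add: at_T_def L.poly T_ac map_poly_map_poly L.zero mk.zero ml.zero
            mpoly_to_ac_mconst o_def)
      let ?R = "\<Sum>i = 3..n. mvar i ^ e i :: 'k alg_closure mpoly"
      have W_ac: "mpoly_to_ac W = mvar 1 ^ e 1 * mvar 2 ^ e 2 + ?R"
        by (simp only: W_def R_def L.add L.mult L.power L.sum mpoly_to_ac_mvar)
      \<comment> \<open>Stated for arbitrary terms so that normalization does not multiply out the
        actual ones.\<close>
      have ring_eq: "v * t + x + y - c * v = v * (t - c) + x + y"
        for v t x y c :: "'k alg_closure mpoly"
        by (simp add: algebra_simps)
      have F: "F = V' * (?T - mconst a\<^sub>0) + poly (map_poly mconst (map_poly to_ac E)) ?T +
          poly (map_poly mconst (map_poly to_ac B)) ?T * (mvar 1 ^ e 1 * mvar 2 ^ e 2 + ?R)"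
        unfolding F_def U_def A_def L.add L.mult T_ac at_T_ac V'_def W_ac by (rule ring_eq)
      show ?thesis
      proof (rule mpoly_absolutely_irreducible[where w = "map_poly to_ac P * w", OF F _ _ _ _ _ _ _ FGH])
        show "N > 0" by fact
        show "e 1 > degree (shear N V')"
          using d_pos[OF one_in] by (simp add: e_def d\<^sub>0_def)
        interpret s: comm_ring_hom "shear N :: 'k alg_closure mpoly \<Rightarrow> _" by (rule shear_hom)
        \<comment> \<open>The shear leaves x_3, ..., x_n as constants in both new variables.\<close>
        have "degree (shear N ?R) \<le> 0"
          unfolding s.sum s.power
          by (intro degree_sum_le) (auto simp: shear_mvar
              simp flip: comm_ring_hom.power[OF comm_ring_hom_const_poly])
        then show "degree (shear N ?R) = 0" by simp
        show "map_poly to_ac B = [:-a\<^sub>0, 1:] * (map_poly to_ac P * w)"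
          unfolding B_def ac.mult w(1) by (simp only: mult_ac)
        show "poly (map_poly to_ac P * w) a\<^sub>0 \<noteq> 0" using P_neq_0 w(2) by simp
        show "poly (map_poly to_ac E) a\<^sub>0 \<noteq> 0" using C(1) by (simp add: E_def)
        fix \<beta> assume "poly (map_poly to_ac B) \<beta> = 0"
        then consider "poly (map_poly to_ac m) \<beta> = 0" | "poly (map_poly to_ac P) \<beta> = 0"
          by (auto simp: B_def ac.mult)
        then show "specialize (mconst \<beta>) (shear N V') * mconst (\<beta> - a\<^sub>0) +
            mconst (poly (map_poly to_ac E) \<beta>) \<noteq> 0"
        proof cases
          case 1
          then show ?thesis using C(2) by (simp add: E_def)
        next
          case 2
          \<comment> \<open>On \<open>S\<close> the term with \<open>E\<close> vanishes, so it
            remains to see that the other product is nonzero; its first factor is zero only if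
            \<open>V'\<close> is.\<close>
          then have "\<beta> \<in> to_ac ` S" by (simp only: P_root)
          then have "\<beta> \<noteq> a\<^sub>0" using assms(3) by blast
          then have "mconst (\<beta> - a\<^sub>0) \<noteq> (0 :: 'k alg_closure mpoly)"
            by (simp add: mconst_eq_0_iff)
          moreover have "specialize (mconst \<beta>) (shear N V') \<noteq> 0"
          proof
            assume "specialize (mconst \<beta>) (shear N V') = 0"
            then have "V' = mconst 0"
              using mpoly_eq_const_if_specialize_const[OF deg_V', of \<beta> 0] by (simp only: ml.zero)
            then show False using \<open>V' \<noteq> 0\<close> by (simp only: ml.zero)
          qed
          ultimately show ?thesis
            using 2 by (simp add: E_def ac.mult ml.zero)
        qed
      qed
    qed
    have "ring_irreducible\<^bsub>mpoly_ring n (simple_ext a\<^sub>0)\<^esub> F"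
      using simple_ext_zero simple_ext_inverse deg_F irr
      by (rule ring_irreducible_if_absolutely_irreducible)
    then show "\<exists>U \<in> carrier (mpoly_ring n UNIV).
       (\<forall>a\<in>S. ring_reducible (mpoly_ring n UNIV) (U - mconst a * V)) \<and>
       ring_irreducible\<^bsub>mpoly_ring n (simple_ext a\<^sub>0)\<^esub>
         (mpoly_to_ac U - mconst a\<^sub>0 * mpoly_to_ac V) \<and>
       total_deg (mpoly_to_ac U - mconst a\<^sub>0 * mpoly_to_ac V) = max (total_deg U) (total_deg V) \<and>
       (\<forall>i\<in>{1..n}. deg_in i U = d i)"
      using U_carrier reducible total_F deg_U unfolding F_def by blast
  qed
qed

end
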